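(* For every integer $w>1$, $$\operatorname{olws}_R(w)\;\ge\;\left\lceil \tfrac{3}{2}w\right\rceil,$$ where $\operatorname{olws}_R(w)$ denotes the on-line width of the class of semi-orders of width at most $w$ presented with (unit-interval) representation.
   Context: Semi-orders with representation. A finite sequence of closed unit-length intervals $[r_1-1,r_1],\ldots,[r_n-1,r_n]$ on the real line (repetitions of the same interval are allowed, and different indices are different elements) represents the poset on elements $x_1,\ldots,x_n$ in which $x_i<x_j$ if and only if $r_i<r_j-1$; thus two distinct elements are incomparable exactly when their intervals intersect. Posets arising in this way are called semi-orders. The width of a poset is the maximum size of an antichain. On-line chain partitioning game. Fix a positive integer $w$. In round $i$ the presenter introduces an element $x_i$ by giving a closed unit interval $[r_i-1,r_i]$ (i.e. the real number $r_i$), such that the semi-order represented by all intervals presented so far has width at most $w$. The (deterministic) on-line algorithm must then immediately and irrevocably assign $x_i$ to a chain, i.e. give it a chain label such that all elements with the same label are pairwise comparable (their intervals are pairwise disjoint). The assignment may depend only on the intervals presented so far and on the chains to which the earlier elements were assigned. The presenter may choose each interval depending on the algorithm's previous assignments. The number of chains used is the number of distinct labels used. On-line width. $\operatorname{olws}_R(w)$ is the largest integer $k$ for which there exists a strategy of the presenter that forces any on-line algorithm to use (at least) $k$ chains on a semi-order of width at most $w$ presented in this way as unit intervals. *)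

theory Defs
  imports Complex_Main
begin

text \<open>
  A presentation is the list of right endpoints r of the closed unit intervals [r - 1, r], in the
  order in which they are presented. The elements of the represented semi-order are the positions
  of the list (counted from 0), so equal intervals at different positions are different elements.
\<close>

definition semiorder_less :: "real list \<Rightarrow> nat \<Rightarrow> nat \<Rightarrow> bool" where
  "semiorder_less rs i j \<longleftrightarrow>
     i < length rs \<and> j < length rs \<and> rs ! i < rs ! j - 1"

definition comparable :: "real list \<Rightarrow> nat \<Rightarrow> nat \<Rightarrow> bool" where
  "comparable rs i j \<longleftrightarrow> semiorder_less rs i j \<or> semiorder_less rs j i"

definition antichain :: "real list \<Rightarrow> nat set \<Rightarrow> bool" where
  "antichain rs X \<longleftrightarrow>
     X \<subseteq> {..<length rs} \<and> (\<forall>i\<in>X. \<forall>j\<in>X. i \<noteq> j \<longrightarrow> \<not> comparable rs i j)"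

definition width :: "real list \<Rightarrow> nat" where
  "width rs = Max {card X |X. antichain rs X}"

text \<open>
  Chain labels are natural numbers. An algorithm receives all intervals presented so far, the
  current one being the last, and the list of labels of the earlier elements.
\<close>

type_synonym algorithm = "real list \<Rightarrow> nat list \<Rightarrow> nat"

primrec labels_upto :: "algorithm \<Rightarrow> real list \<Rightarrow> nat \<Rightarrow> nat list" where
  "labels_upto A rs 0 = []"
| "labels_upto A rs (Suc n) =
     labels_upto A rs n @ [A (take (Suc n) rs) (labels_upto A rs n)]"

definition labels :: "algorithm \<Rightarrow> real list \<Rightarrow> nat list" where
  "labels A rs = labels_upto A rs (length rs)"

definition chain_partition :: "real list \<Rightarrow> nat list \<Rightarrow> bool" where
  "chain_partition rs cs \<longleftrightarrow> length cs = length rs \<and>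
     (\<forall>i<length rs. \<forall>j<length rs. i \<noteq> j \<longrightarrow> cs ! i = cs ! j \<longrightarrow> comparable rs i j)"

text \<open>An algorithm may be designed for a particular w; it has to be correct on every presentation
  of width at most w.\<close>

definition online_algorithm :: "nat \<Rightarrow> algorithm \<Rightarrow> bool" where
  "online_algorithm w A \<longleftrightarrow> (\<forall>rs. width rs \<le> w \<longrightarrow> chain_partition rs (labels A rs))"

text \<open>A presenter strategy chooses the next interval from the intervals presented so far and
  the labels they received.\<close>

type_synonym presenter = "real list \<Rightarrow> nat list \<Rightarrow> real"

primrec play :: "presenter \<Rightarrow> algorithm \<Rightarrow> nat \<Rightarrow> real list" where
  "play P A 0 = []"
| "play P A (Suc n) = play P A n @ [P (play P A n) (labels A (play P A n))]"

text \<open>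
  The presenter stops after some round n, which may depend on the play. Since width is monotone
  under extension of a presentation, the bound at round n entails the bound at all earlier rounds;
  what the strategy would present after round n is irrelevant.
\<close>

definition forces :: "nat \<Rightarrow> presenter \<Rightarrow> nat \<Rightarrow> bool" where
  "forces w P k \<longleftrightarrow> (\<forall>A. online_algorithm w A \<longrightarrow>
     (\<exists>n. width (play P A n) \<le> w \<and> k \<le> card (set (labels A (play P A n)))))"

definition olws_R :: "nat \<Rightarrow> nat" where
  "olws_R w = (GREATEST k. \<exists>P. forces w P k)"

end

theory Submission
  imports Defs
begin

text \<open>
  The presenter builds a clique X on the left and a clique Y on the right that do not meet, and then
  plays intervals in the middle, each of which meets a final segment of X and an initial segment of
  Y. Every new interval of Y can be inserted in a gap chosen beforehand, so elements whose colours
  lie in a prescribed class end up to the left of the gap and all others to its right.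

  For w = 2h, let X have h elements. Among 2h elements of Y at least h have a colour not occurring
  in X, and these can be sorted to the left; h middle intervals meeting X and exactly these h
  elements bring the total to 3h.

  For w = 2k + 1, two colour-disjoint segments of size k + 1 with k middle intervals give the desired
  3k + 2 colours, so the algorithm has to prevent this. It suffices to have k + 1 final elements of
  X, coloured R, and k initial elements of Y, coloured disjointly from R, such that the next at most
  k elements of Y include the colour of the leftmost element of R: k middle intervals
  that meet the two segments exhaust k further colours, and one more interval slightly to their right,
  which loses the leftmost element of R but regains its colour from Y, needs yet another. A case
  distinction on the first colour that X and Y share leads to this configuration or to two disjoint
  segments in the wrong relative order; the latter is settled by the middle intervals themselves.

  That the maximum defining the on-line width exists follows from first fit: an
  interval meets at most 2w others.
\<close>

section \<open>Bounding the on-line width by first fit\<close>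

lemma width_le_iff: "width rs \<le> w \<longleftrightarrow> (\<forall>X. antichain rs X \<longrightarrow> card X \<le> w)"
proof -
  have "{card X |X. antichain rs X} \<subseteq> card ` Pow {..<length rs}"
    unfolding antichain_def by auto
  then have fin: "finite {card X |X. antichain rs X}"
    by (rule finite_subset) simp
  have "antichain rs {}"
    unfolding antichain_def by simp
  then have "{card X |X. antichain rs X} \<noteq> {}"
    by blast
  with fin show ?thesis
    unfolding width_def by (subst Max_le_iff) auto
qed

lemma comparable_sym: "comparable rs i j \<longleftrightarrow> comparable rs j i"
  unfolding comparable_def by auto

lemma length_labels_upto [simp]: "length (labels_upto A rs n) = n"
  by (induction n) auto

lemma length_labels [simp]: "length (labels A rs) = length rs"
  by (simp add: labels_def)

lemma labels_upto_append: "n \<le> length rs \<Longrightarrow> labels_upto A (rs @ ys) n = labels_upto A rs n"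
  by (induction n) auto

lemma labels_snoc: "labels A (rs @ [r]) = labels A rs @ [A (rs @ [r]) (labels A rs)]"
  by (simp add: labels_def labels_upto_append)

lemma take_labels_append: "take (length rs) (labels A (rs @ ys)) = labels A rs"
proof (induction ys rule: rev_induct)
  case (snoc y ys)
  then show ?case
    using labels_snoc[of A "rs @ ys" y] by simp
qed simp

text \<open>The list \<open>cs\<close> covers only the earlier elements, so \<open>length cs\<close>
  is the index of the interval being coloured now.\<close>

definition first_fit :: algorithm where
  "first_fit rs cs = (LEAST c. \<forall>i<length cs. cs ! i = c \<longrightarrow> comparable rs i (length cs))"

lemma first_fit_comparable:
  assumes "i < length cs" "cs ! i = first_fit rs cs"
  shows "comparable rs i (length cs)"
proof -
  obtain c where "c \<notin> set cs"
    using ex_new_if_finite[OF infinite_UNIV_nat finite_set] by blast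
  then have "\<forall>i<length cs. cs ! i = c \<longrightarrow> comparable rs i (length cs)"
    by auto
  from LeastI[of "\<lambda>c. \<forall>i<length cs. cs ! i = c \<longrightarrow> comparable rs i (length cs)", OF this]
  show ?thesis
    using assms unfolding first_fit_def by blast
qed

lemma first_fit_blocked:
  assumes "c < first_fit rs cs"
  shows "\<exists>i<length cs. cs ! i = c \<and> \<not> comparable rs i (length cs)"
  using not_less_Least[OF assms[unfolded first_fit_def]] by blast

lemma comparable_append:
  "i < length rs \<Longrightarrow> j < length rs \<Longrightarrow> comparable (rs @ ys) i j \<longleftrightarrow> comparable rs i j"
  unfolding comparable_def semiorder_less_def by (auto simp: nth_append)

lemma chain_partition_first_fit: "chain_partition rs (labels first_fit rs)"
proof (induction rs rule: rev_induct)
  case Nil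
  then show ?case by (simp add: chain_partition_def)
next
  case (snoc r rs)
  let ?cs = "labels first_fit rs"
  have new: "comparable (rs @ [r]) i (length rs)"
    if "i < length rs" "?cs ! i = first_fit (rs @ [r]) ?cs" for i
    using first_fit_comparable[of i ?cs "rs @ [r]"] that by simp
  have old: "comparable (rs @ [r]) i j"
    if "i < length rs" "j < length rs" "i \<noteq> j" "?cs ! i = ?cs ! j" for i j
    using snoc that by (simp add: chain_partition_def comparable_append)
  show ?case
    unfolding chain_partition_def labels_snoc
    using new old comparable_sym[of "rs @ [r]"]
    by (auto simp: nth_append less_Suc_eq)
qed

text \<open>Closed unit intervals whose right endpoints differ by at most 1 intersect, so the
  endpoints in a closed window of length 1 come from an antichain.\<close>

lemma card_interval_le_width:
  assumes "width rs \<le> w"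
  shows "card {j. j < length rs \<and> t \<le> rs ! j \<and> rs ! j \<le> t + 1} \<le> w"
proof -
  have "antichain rs {j. j < length rs \<and> t \<le> rs ! j \<and> rs ! j \<le> t + 1}"
    unfolding antichain_def comparable_def semiorder_less_def by auto
  then show ?thesis
    using assms width_le_iff by blast
qed

lemma width_append_le:
  assumes "width (rs @ ys) \<le> w"
  shows "width rs \<le> w"
proof -
  have "antichain (rs @ ys) X" if "antichain rs X" for X
    using that unfolding antichain_def
    by (auto simp: comparable_append subset_eq)
  then show ?thesis
    using assms by (simp add: width_le_iff)
qed

text \<open>Each label below the chosen one is carried by an interval that meets the new one. The
  endpoint of such an interval lies in one of the two unit windows that begin at
  \<open>r - 1\<close> and at \<open>r\<close>, and each window holds at most \<open>w\<close>
  endpoints.\<close>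

lemma first_fit_le:
  assumes "width (rs @ [r]) \<le> w"
  shows "first_fit (rs @ [r]) (labels first_fit rs) \<le> 2 * w"
proof -
  let ?rs = "rs @ [r]" and ?cs = "labels first_fit rs" and ?n = "length rs"
  let ?I = "\<lambda>t. {j. j < length ?rs \<and> t \<le> ?rs ! j \<and> ?rs ! j \<le> t + 1}"
  have "{..<first_fit ?rs ?cs} \<subseteq> (\<lambda>i. ?cs ! i) ` (?I (r - 1) \<union> ?I r)"
  proof
    fix c assume "c \<in> {..<first_fit ?rs ?cs}"
    then obtain i where "i < ?n" "?cs ! i = c" "\<not> comparable ?rs i ?n"
      using first_fit_blocked[of c ?rs ?cs] by auto
    moreover from this have "i \<in> ?I (r - 1) \<union> ?I r"
      unfolding comparable_def semiorder_less_def by (auto simp: nth_append)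
    ultimately show "c \<in> (\<lambda>i. ?cs ! i) ` (?I (r - 1) \<union> ?I r)"
      by blast
  qed
  then have "card {..<first_fit ?rs ?cs} \<le> card ((\<lambda>i. ?cs ! i) ` (?I (r - 1) \<union> ?I r))"
    by (intro card_mono) auto
  also have "\<dots> \<le> card (?I (r - 1) \<union> ?I r)"
    by (intro card_image_le) auto
  also have "\<dots> \<le> card (?I (r - 1)) + card (?I r)"
    by (rule card_Un_le)
  also have "\<dots> \<le> w + w"
    by (intro add_mono card_interval_le_width assms)
  finally show ?thesis by simp
qed

lemma labels_first_fit_subset:
  "width rs \<le> w \<Longrightarrow> set (labels first_fit rs) \<subseteq> {..2 * w}"
proof (induction rs rule: rev_induct)
  case Nil
  then show ?case by (simp add: labels_def)
next
  case (snoc r rs)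
  then show ?case
    using width_append_le[of rs "[r]" w] first_fit_le[of rs r w] by (simp add: labels_snoc)
qed

lemma forces_le:
  assumes "forces w P k"
  shows "k \<le> Suc (2 * w)"
proof -
  have "online_algorithm w first_fit"
    by (simp add: online_algorithm_def chain_partition_first_fit)
  then obtain n where "width (play P first_fit n) \<le> w"
    and "k \<le> card (set (labels first_fit (play P first_fit n)))"
    using assms unfolding forces_def by blast
  moreover have "card (set (labels first_fit rs)) \<le> card {..2 * w}" if "width rs \<le> w" for rs
    using labels_first_fit_subset[OF that] by (intro card_mono) auto
  ultimately show ?thesis
    using order_trans by fastforce
qed

text \<open>\<open>GREATEST\<close> has its intended value only on a bounded set. First fit supplies
  the bound, so from here on exhibiting one strategy is enough.\<close>

lemma forces_imp_le_olws_R: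
  assumes "forces w P k"
  shows "k \<le> olws_R w"
  unfolding olws_R_def
  by (rule Greatest_le_nat[where b = "Suc (2 * w)"]) (use assms forces_le in blast)+

section \<open>From positions to presenter strategies\<close>

text \<open>
  A position is the set of pairs of a right endpoint and a label; no information is lost, since equal
  intervals always receive different labels.
\<close>

inductive wins :: "nat \<Rightarrow> nat \<Rightarrow> (real \<times> nat) set \<Rightarrow> bool" for w K where
  wins_done: "K \<le> card (snd ` S) \<Longrightarrow> wins w K S"
| wins_step: "(\<And>t. t \<le> r \<Longrightarrow> r \<le> t + 1 \<Longrightarrow> card {p \<in> S. t \<le> fst p \<and> fst p \<le> t + 1} < w) \<Longrightarrow>
    (\<And>c. (\<And>s d. (s, d) \<in> S \<Longrightarrow> \<bar>s - r\<bar> \<le> 1 \<Longrightarrow> d \<noteq> c) \<Longrightarrow> wins w K (insert (r, c) S)) \<Longrightarrow>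
    wins w K S"

text \<open>An antichain that contains the new element lies in the unit window starting at its
  smallest endpoint \<open>t\<close>. This window contains \<open>r\<close>, so the hypothesis
  leaves room for one more element.\<close>

lemma width_snoc_le:
  assumes w: "width rs \<le> w" and chains: "chain_partition rs cs"
    and win: "\<And>t. t \<le> r \<Longrightarrow> r \<le> t + 1 \<Longrightarrow>
      card {p \<in> set (zip rs cs). t \<le> fst p \<and> fst p \<le> t + 1} < w"
  shows "width (rs @ [r]) \<le> w"
  unfolding width_le_iff
proof (intro allI impI)
  fix X assume X: "antichain (rs @ [r]) X"
  let ?n = "length rs" and ?rs = "rs @ [r]"
  from X have sub: "X \<subseteq> {..<Suc ?n}"
    unfolding antichain_def by simp
  then have fin: "finite X"
    by (rule finite_subset) simp
  have close: "?rs ! j \<le> ?rs ! i + 1" if "i \<in> X" "j \<in> X" for i j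
  proof (cases "i = j")
    case False
    then have "\<not> comparable ?rs i j"
      using X that unfolding antichain_def by blast
    moreover have "i < Suc ?n" "j < Suc ?n"
      using sub that by auto
    ultimately show ?thesis
      unfolding comparable_def semiorder_less_def by simp
  qed simp
  show "card X \<le> w"
  proof (cases "?n \<in> X")
    case False
    with sub have "X \<subseteq> {..<?n}"
      by (auto simp: less_Suc_eq)
    then have "antichain rs X"
      using X unfolding antichain_def by (auto simp: comparable_append subset_eq)
    with w show ?thesis
      by (simp add: width_le_iff)
  next
    case True
    define t where "t = Min ((!) ?rs ` X)"
    have "t \<in> (!) ?rs ` X"
      unfolding t_def using fin True by (intro Min_in) auto
    then obtain i0 where i0: "i0 \<in> X" "t = ?rs ! i0"
      by blast
    have t: "t \<le> ?rs ! i" "?rs ! i \<le> t + 1" if "i \<in> X" for i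
    proof -
      show "t \<le> ?rs ! i"
        unfolding t_def using fin that by (intro Min_le) auto
      show "?rs ! i \<le> t + 1"
        unfolding i0(2) by (rule close[OF i0(1) that])
    qed
    let ?f = "\<lambda>i. (rs ! i, cs ! i)" and ?S = "{p \<in> set (zip rs cs). t \<le> fst p \<and> fst p \<le> t + 1}"
    have len: "length cs = ?n"
      using chains by (simp add: chain_partition_def)
    have less: "i < ?n" if "i \<in> X - {?n}" for i
      using that sub by (auto simp: less_Suc_eq)
    \<comment> \<open>Equal labels would force comparability, which an antichain excludes. Hence
      counting pairs of endpoint and label counts elements.\<close>
    have "inj_on ?f (X - {?n})"
    proof (rule inj_onI, rule ccontr)
      fix i j assume ij: "i \<in> X - {?n}" "j \<in> X - {?n}" "?f i = ?f j" "i \<noteq> j"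
      then have "comparable rs i j"
        using chains less by (auto simp: chain_partition_def)
      then have "comparable ?rs i j"
        using less[OF ij(1)] less[OF ij(2)] by (simp add: comparable_append)
      then show False
        using X ij unfolding antichain_def by blast
    qed
    moreover have "?f ` (X - {?n}) \<subseteq> ?S"
    proof (rule image_subsetI)
      fix i assume i: "i \<in> X - {?n}"
      then have "(rs ! i, cs ! i) \<in> set (zip rs cs)"
        using nth_mem[of i "zip rs cs"] less[OF i] len by simp
      moreover have "t \<le> rs ! i" "rs ! i \<le> t + 1"
        using t[of i] i less[OF i] by (simp_all add: nth_append)
      ultimately show "?f i \<in> ?S"
        by simp
    qed
    moreover have "finite ?S"
      by (rule finite_subset[of _ "set (zip rs cs)"]) auto
    ultimately have "card (X - {?n}) \<le> card ?S"
      by (rule card_inj_on_le)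
    also have "\<dots> < w"
      using t[OF True] by (intro win) (simp_all add: nth_append)
    finally show ?thesis
      using fin True by (simp add: card_Diff_singleton)
  qed
qed

text \<open>Unlike \<open>play\<close>, iterating \<open>extend\<close> can resume from any
  presentation, as the induction over \<open>wins\<close> requires.\<close>

definition extend :: "presenter \<Rightarrow> algorithm \<Rightarrow> real list \<Rightarrow> real list" where
  "extend P A rs = rs @ [P rs (labels A rs)]"

lemma play_eq_extend: "play P A n = (extend P A ^^ n) []"
  by (induction n) (simp_all add: extend_def)

lemma extend_funpow_append: "\<exists>ys. (extend P A ^^ n) rs = rs @ ys"
  by (induction n) (auto simp: extend_def)

lemma extend_funpow_cong:
  fixes P Q :: presenter
  assumes "\<And>ys. P (rs @ ys) (labels A (rs @ ys)) = Q (rs @ ys) (labels A (rs @ ys))"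
  shows "(extend P A ^^ n) rs = (extend Q A ^^ n) rs"
proof (induction n)
  case (Suc n)
  obtain ys where "(extend Q A ^^ n) rs = rs @ ys"
    using extend_funpow_append by blast
  with Suc show ?case
    using assms[of ys] by (simp add: extend_def[of P A "rs @ ys"] extend_def[of Q A "rs @ ys"])
qed simp

text \<open>A single \<open>P\<close> has to serve all algorithms that have produced
  \<open>cs\<close>. The induction gives one strategy for each possible next label, and these are
  glued together by letting \<open>P\<close> read that label from the history.\<close>

lemma wins_imp_strategy:
  assumes "wins w K S" "S = set (zip rs cs)" "chain_partition rs cs" "width rs \<le> w"
  shows "\<exists>P. \<forall>A. online_algorithm w A \<longrightarrow> labels A rs = cs \<longrightarrow>
    (\<exists>n. width ((extend P A ^^ n) rs) \<le> w \<and> K \<le> card (set (labels A ((extend P A ^^ n) rs))))"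
  using assms
proof (induction arbitrary: rs cs rule: wins.induct)
  case (wins_done S)
  then have "set cs = snd ` S"
    by (metis chain_partition_def list.set_map map_snd_zip)
  with wins_done show ?case
    \<comment> \<open>The game stops at once with \<open>n = 0\<close>, hence the arbitrary
      strategy.\<close>
    by (intro exI[of _ undefined] allI impI exI[of _ 0]) auto
next
  case (wins_step r S)
  let ?n = "length rs"
  have len: "length cs = ?n"
    using wins_step.prems by (simp add: chain_partition_def)
  have w: "width (rs @ [r]) \<le> w"
    using wins_step.prems wins_step.hyps by (intro width_snoc_le[of rs w cs]) auto
  have "\<exists>P. \<forall>A. online_algorithm w A \<longrightarrow> labels A (rs @ [r]) = cs @ [c] \<longrightarrow>
      (\<exists>n. width ((extend P A ^^ n) (rs @ [r])) \<le> w \<and>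
        K \<le> card (set (labels A ((extend P A ^^ n) (rs @ [r])))))" for c
  proof (cases "chain_partition (rs @ [r]) (cs @ [c])")
    case True
    have "d \<noteq> c" if "(s, d) \<in> S" "\<bar>s - r\<bar> \<le> 1" for s d
    proof
      assume "d = c"
      from that wins_step.prems(1) obtain i where i: "i < ?n" "rs ! i = s" "cs ! i = d"
        using len by (auto simp: set_zip)
      with True \<open>d = c\<close> len have "comparable (rs @ [r]) i ?n"
        unfolding chain_partition_def by (auto simp: nth_append)
      with i that show False
        unfolding comparable_def semiorder_less_def by (auto simp: nth_append)
    qed
    then show ?thesis
      using True w len wins_step.prems(1) by (intro wins_step.IH) auto
  next
    \<comment> \<open>No correct algorithm gives such a reply, because the width is still at most
      \<open>w\<close>; the claim is vacuous.\<close>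
    case False
    then show ?thesis
      using w by (metis online_algorithm_def)
  qed
  then obtain Q where Q: "\<And>c A. online_algorithm w A \<Longrightarrow> labels A (rs @ [r]) = cs @ [c] \<Longrightarrow>
      \<exists>n. width ((extend (Q c) A ^^ n) (rs @ [r])) \<le> w \<and>
        K \<le> card (set (labels A ((extend (Q c) A ^^ n) (rs @ [r]))))"
    by metis
  \<comment> \<open>Index \<open>?n\<close> of the label list holds the reply to \<open>r\<close>,
    so after that round \<open>P\<close> knows which \<open>Q c\<close> to follow.\<close>
  define P where "P = (\<lambda>xs ds. if length xs = ?n then r else Q (ds ! ?n) xs ds)"
  show ?case
  proof (intro exI[of _ P] allI impI)
    fix A assume A: "online_algorithm w A" "labels A rs = cs"
    define c where "c = A (rs @ [r]) cs"
    have c: "labels A (rs @ [r]) = cs @ [c]"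
      by (simp add: labels_snoc A c_def)
    have "labels A (rs @ [r] @ ys) ! ?n = c" for ys
    proof -
      have "take (Suc ?n) (labels A ((rs @ [r]) @ ys)) = cs @ [c]"
        using take_labels_append[of "rs @ [r]" A ys] c by simp
      then show ?thesis
        using len by (metis append.assoc lessI nth_append_length nth_take)
    qed
    then have "(extend P A ^^ n) (rs @ [r]) = (extend (Q c) A ^^ n) (rs @ [r])" for n
      by (intro extend_funpow_cong) (simp add: P_def)
    moreover have "extend P A rs = rs @ [r]"
      by (simp add: extend_def P_def)
    ultimately have "(extend P A ^^ Suc n) rs = (extend (Q c) A ^^ n) (rs @ [r])" for n
      by (simp add: funpow_swap1)
    then show "\<exists>n. width ((extend P A ^^ n) rs) \<le> w \<and>
        K \<le> card (set (labels A ((extend P A ^^ n) rs)))"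
      using Q[OF A(1) c] by metis
  qed
qed

lemma wins_empty_imp_forces:
  assumes "wins w K {}"
  shows "\<exists>P. forces w P K"
proof -
  have "width [] \<le> w"
    by (simp add: width_le_iff antichain_def)
  then show ?thesis
    using wins_imp_strategy[OF assms, of "[]" "[]"]
    by (simp add: forces_def play_eq_extend chain_partition_def labels_def)
qed

section \<open>Two cliques and the intervals between them\<close>

text \<open>
  All coordinates v lie strictly between 0 and 1, and the cliques are shifted by one to either side.
  Thus X and Y do not meet, and a middle element at m meets exactly the elements of X at coordinates
  at least m and the elements of Y at coordinates at most m.
\<close>

definition place :: "(real \<times> nat) set \<Rightarrow> (real \<times> nat) set \<Rightarrow> (real \<times> nat) set \<Rightarrow> (real \<times> nat) set" where
  "place X M Y = (\<lambda>(v, c). (v - 1, c)) ` X \<union> M \<union> (\<lambda>(v, c). (v + 1, c)) ` Y"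

text \<open>A clique together with its colours: endpoints in an open interval of length 1 belong to
  pairwise intersecting intervals, so their colours are distinct.\<close>

definition row :: "(real \<times> nat) set \<Rightarrow> bool" where
  "row Z \<longleftrightarrow> finite Z \<and> inj_on snd Z \<and> (\<forall>p\<in>Z. 0 < fst p \<and> fst p < 1)"

definition above :: "real \<Rightarrow> (real \<times> nat) set \<Rightarrow> (real \<times> nat) set" where
  "above a Z = {p \<in> Z. a \<le> fst p}"

definition below :: "real \<Rightarrow> (real \<times> nat) set \<Rightarrow> (real \<times> nat) set" where
  "below a Z = {p \<in> Z. fst p \<le> a}"

lemma row_empty [simp]: "row {}"
  by (simp add: row_def)

lemma row_insert: "row Z \<Longrightarrow> 0 < z \<Longrightarrow> z < 1 \<Longrightarrow> c \<notin> snd ` Z \<Longrightarrow> row (insert (z, c) Z)"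
  unfolding row_def by (auto simp: inj_on_insert)

lemma row_subset: "row Z \<Longrightarrow> A \<subseteq> Z \<Longrightarrow> row A"
  unfolding row_def by (auto intro: finite_subset inj_on_subset)

lemma row_card_snd: "row Z \<Longrightarrow> card (snd ` Z) = card Z"
  unfolding row_def by (simp add: card_image)

lemma row_finite: "row Z \<Longrightarrow> finite Z"
  unfolding row_def by simp

lemma above_subset: "above a Z \<subseteq> Z" and below_subset: "below a Z \<subseteq> Z"
  unfolding above_def below_def by auto

lemma above_insert: "above a (insert p Z) = (if a \<le> fst p then insert p (above a Z) else above a Z)"
  and below_insert: "below a (insert p Z) = (if fst p \<le> a then insert p (below a Z) else below a Z)"
  unfolding above_def below_def by auto

lemma above_antimono: "a \<le> b \<Longrightarrow> above b Z \<subseteq> above a Z"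
  and below_mono: "a \<le> b \<Longrightarrow> below a Z \<subseteq> below b Z"
  unfolding above_def below_def by auto

lemma snd_place: "snd ` place X M Y = snd ` X \<union> snd ` M \<union> snd ` Y"
  unfolding place_def image_Un by (simp add: image_image case_prod_beta)

text \<open>A unit window containing an endpoint of the left block ends before 1 and so misses the
  right block. While there are no middle intervals, only the size of \<open>X\<close> limits the
  width. \<open>Y_step\<close> is the mirror image.\<close>

lemma X_step:
  assumes X: "row X" "card X < w" and Y: "row Y" and x: "0 < x" "x < 1"
    and reply: "\<And>c. c \<notin> snd ` X \<Longrightarrow> wins w K (place (insert (x, c) X) {} Y)"
  shows "wins w K (place X {} Y)"
proof (rule wins_step[where r = "x - 1"])
  fix t assume t: "t \<le> x - 1" "x - 1 \<le> t + 1"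
  let ?S = "{p \<in> place X {} Y. t \<le> fst p \<and> fst p \<le> t + 1}"
  have "?S \<subseteq> (\<lambda>(v, c). (v - 1, c)) ` X"
    using t x Y unfolding place_def row_def by fastforce
  then have "card ?S \<le> card X"
    by (rule surj_card_le[OF row_finite[OF X(1)]])
  with X(2) show "card ?S < w"
    by simp
next
  fix c assume c: "\<And>s d. (s, d) \<in> place X {} Y \<Longrightarrow> \<bar>s - (x - 1)\<bar> \<le> 1 \<Longrightarrow> d \<noteq> c"
  have "c \<notin> snd ` X"
  proof
    assume "c \<in> snd ` X"
    then obtain v where v: "(v, c) \<in> X" by force
    then have "(v - 1, c) \<in> place X {} Y" unfolding place_def by force
    moreover have "\<bar>v - 1 - (x - 1)\<bar> \<le> 1" using v X x unfolding row_def by fastforce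
    ultimately show False using c by blast
  qed
  then show "wins w K (insert (x - 1, c) (place X {} Y))"
    using reply[of c] unfolding place_def by simp
qed

lemma Y_step:
  assumes Y: "row Y" "card Y < w" and X: "row X" and y: "0 < y" "y < 1"
    and reply: "\<And>c. c \<notin> snd ` Y \<Longrightarrow> wins w K (place X {} (insert (y, c) Y))"
  shows "wins w K (place X {} Y)"
proof (rule wins_step[where r = "y + 1"])
  fix t assume t: "t \<le> y + 1" "y + 1 \<le> t + 1"
  let ?S = "{p \<in> place X {} Y. t \<le> fst p \<and> fst p \<le> t + 1}"
  have "?S \<subseteq> (\<lambda>(v, c). (v + 1, c)) ` Y"
    using t y X unfolding place_def row_def by fastforce
  then have "card ?S \<le> card Y"
    by (rule surj_card_le[OF row_finite[OF Y(1)]])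
  with Y(2) show "card ?S < w"
    by simp
next
  fix c assume c: "\<And>s d. (s, d) \<in> place X {} Y \<Longrightarrow> \<bar>s - (y + 1)\<bar> \<le> 1 \<Longrightarrow> d \<noteq> c"
  have "c \<notin> snd ` Y"
  proof
    assume "c \<in> snd ` Y"
    then obtain v where v: "(v, c) \<in> Y" by force
    then have "(v + 1, c) \<in> place X {} Y" unfolding place_def by force
    moreover have "\<bar>v + 1 - (y + 1)\<bar> \<le> 1" using v Y y unfolding row_def by fastforce
    ultimately show False using c by blast
  qed
  then show "wins w K (insert (y + 1, c) (place X {} Y))"
    using reply[of c] unfolding place_def by simp
qed

text \<open>No unit window reaches both outer blocks: it misses \<open>X\<close> if
  \<open>t \<ge> 0\<close> and \<open>Y\<close> if \<open>t < 0\<close>. The hypotheses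
  \<open>right\<close> and \<open>left\<close> bound these two kinds of window, with
  \<open>a = t\<close> and \<open>a = t + 1\<close>.\<close>

lemma M_step:
  assumes rows: "row X" "row M" "row Y" and m: "0 < m" "m < 1"
    and left: "\<And>a. m \<le> a \<Longrightarrow> card (above a X) + card (below a M) < w"
    and right: "\<And>a. a \<le> m \<Longrightarrow> card (above a M) + card (below a Y) < w"
    and reply: "\<And>c. c \<notin> snd ` (above m X \<union> M \<union> below m Y) \<Longrightarrow>
      wins w K (place X (insert (m, c) M) Y)"
  shows "wins w K (place X M Y)"
proof (rule wins_step[where r = m])
  fix t assume t: "t \<le> m" "m \<le> t + 1"
  let ?S = "{p \<in> place X M Y. t \<le> fst p \<and> fst p \<le> t + 1}"
  have fin: "finite X" "finite M" "finite Y"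
    using rows row_finite by auto
  have shift: "card (f ` A \<union> B) \<le> card A + card B" if "finite A" for f and A B :: "(real \<times> nat) set"
    using card_Un_le[of "f ` A" B] card_image_le[OF that, of f] by linarith
  have fin': "finite (above a Z)" "finite (below a Z)" if "finite Z" for a Z
    using that unfolding above_def below_def by auto
  show "card ?S < w"
  proof (cases "0 \<le> t")
    case True
    have "?S \<subseteq> (\<lambda>(v, c). (v + 1, c)) ` below t Y \<union> above t M"
      using True rows t m unfolding place_def row_def above_def below_def by fastforce
    then have "card ?S \<le> card ((\<lambda>(v, c). (v + 1, c)) ` below t Y \<union> above t M)"
      using fin fin' by (intro card_mono) auto
    also have "\<dots> \<le> card (below t Y) + card (above t M)"
      using fin fin' by (intro shift) auto
    also have "\<dots> < w"
      using right[of t] t by simp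
    finally show ?thesis .
  next
    case False
    have "?S \<subseteq> (\<lambda>(v, c). (v - 1, c)) ` above (t + 1) X \<union> below (t + 1) M"
      using False rows t m unfolding place_def row_def above_def below_def by fastforce
    then have "card ?S \<le> card ((\<lambda>(v, c). (v - 1, c)) ` above (t + 1) X \<union> below (t + 1) M)"
      using fin fin' by (intro card_mono) auto
    also have "\<dots> \<le> card (above (t + 1) X) + card (below (t + 1) M)"
      using fin fin' by (intro shift) auto
    also have "\<dots> < w"
      using left[of "t + 1"] t by simp
    finally show ?thesis .
  qed
next
  fix c assume c: "\<And>s d. (s, d) \<in> place X M Y \<Longrightarrow> \<bar>s - m\<bar> \<le> 1 \<Longrightarrow> d \<noteq> c"
  have "c \<noteq> d" if "(v, d) \<in> above m X" for v d
    using that c[of "v - 1" d] rows(1) m unfolding above_def place_def row_def by force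
  moreover have "c \<noteq> d" if "(v, d) \<in> M" for v d
    using that c[of v d] rows(2) m unfolding place_def row_def by force
  moreover have "c \<noteq> d" if "(v, d) \<in> below m Y" for v d
    using that c[of "v + 1" d] rows(3) m unfolding below_def place_def row_def by force
  ultimately have "c \<notin> snd ` (above m X \<union> M \<union> below m Y)"
    by fastforce
  then show "wins w K (insert (m, c) (place X M Y))"
    using reply[of c] unfolding place_def by simp
qed

section \<open>Several middle intervals at one point\<close>

lemma card_above_insert_le: "finite Z \<Longrightarrow> card (above a (insert p Z)) \<le> Suc (card (above a Z))"
  and card_below_insert_le: "finite Z \<Longrightarrow> card (below a (insert p Z)) \<le> Suc (card (below a Z))"
  by (simp_all add: above_insert below_insert card_insert_if
      finite_subset[OF above_subset] finite_subset[OF below_subset])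

text \<open>The summand \<open>n\<close> reserves room for the intervals still to come: each of them
  raises a count by at most 1 while \<open>n\<close> drops by 1. Being equal, they receive distinct
  colours, collected in \<open>C\<close>.\<close>

lemma fill:
  assumes "row X" "row M" "row Y" "0 < m" "m < 1"
    and "\<And>a. m \<le> a \<Longrightarrow> card (above a X) + card (below a M) + n \<le> w"
    and "\<And>a. a \<le> m \<Longrightarrow> card (above a M) + card (below a Y) + n \<le> w"
    and "\<And>C. finite C \<Longrightarrow> card C = n \<Longrightarrow> C \<inter> snd ` (above m X \<union> M \<union> below m Y) = {} \<Longrightarrow>
      wins w K (place X (M \<union> Pair m ` C) Y)"
  shows "wins w K (place X M Y)"
  using assms
proof (induction n arbitrary: M)
  case 0
  then show ?case
    using "0.prems"(8)[of "{}"] by simp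
next
  case (Suc n)
  have finM: "finite M"
    using Suc.prems row_finite by blast
  show ?case
  proof (rule M_step)
    fix c assume c: "c \<notin> snd ` (above m X \<union> M \<union> below m Y)"
    show "wins w K (place X (insert (m, c) M) Y)"
    proof (rule Suc.IH)
      show "row (insert (m, c) M)"
        using Suc.prems c by (intro row_insert) auto
    next
      fix a assume "m \<le> a"
      then show "card (above a X) + card (below a (insert (m, c) M)) + n \<le> w"
        using Suc.prems(6)[of a] card_below_insert_le[OF finM, of a "(m, c)"] by linarith
    next
      fix a assume "a \<le> m"
      then show "card (above a (insert (m, c) M)) + card (below a Y) + n \<le> w"
        using Suc.prems(7)[of a] card_above_insert_le[OF finM, of a "(m, c)"] by linarith
    next
      fix C assume C: "finite C" "card C = n"
        "C \<inter> snd ` (above m X \<union> insert (m, c) M \<union> below m Y) = {}"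
      then have "wins w K (place X (M \<union> Pair m ` insert c C) Y)"
        using c by (intro Suc.prems(8)) auto
      then show "wins w K (place X (insert (m, c) M \<union> Pair m ` C) Y)"
        by simp
    qed (use Suc.prems in auto)
  next
    fix a assume "m \<le> a"
    then show "card (above a X) + card (below a M) < w"
      using Suc.prems(6)[of a] by linarith
  next
    fix a assume "a \<le> m"
    then show "card (above a M) + card (below a Y) < w"
      using Suc.prems(7)[of a] by linarith
  qed (use Suc.prems in auto)
qed

lemma fill_wins:
  assumes rows: "row X" "row M" "row Y" and m: "0 < m" "m < 1"
    and left: "\<And>a. m \<le> a \<Longrightarrow> card (above a X) + card (below a M) + n \<le> w"
    and right: "\<And>a. a \<le> m \<Longrightarrow> card (above a M) + card (below a Y) + n \<le> w"
    and K: "K \<le> card (snd ` (above m X \<union> M \<union> below m Y)) + n"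
  shows "wins w K (place X M Y)"
proof -
  let ?S = "snd ` (above m X \<union> M \<union> below m Y)"
  have fin: "finite X" "finite M" "finite Y"
    using rows row_finite by auto
  then have finS: "finite ?S"
    using finite_subset[OF above_subset] finite_subset[OF below_subset] by auto
  have *: "wins w K (place X (M \<union> Pair m ` C) Y)"
    if C: "finite C" "card C = n" "C \<inter> ?S = {}" for C
  proof (rule wins_done)
    have "K \<le> card (?S \<union> C)"
      using C K card_Un_disjoint[OF finS C(1)] by (simp add: Int_commute)
    also have "\<dots> \<le> card (snd ` place X (M \<union> Pair m ` C) Y)"
    proof (rule card_mono)
      show "finite (snd ` place X (M \<union> Pair m ` C) Y)"
        using fin C(1) by (simp add: place_def)
      have "snd ` above m X \<subseteq> snd ` X" "snd ` below m Y \<subseteq> snd ` Y"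
        by (intro image_mono above_subset below_subset)+
      then show "?S \<union> C \<subseteq> snd ` place X (M \<union> Pair m ` C) Y"
        by (simp add: snd_place image_Un image_image le_supI1 le_supI2)
    qed
    finally show "K \<le> card (snd ` place X (M \<union> Pair m ` C) Y)" .
  qed
  show ?thesis
    by (rule fill[OF rows m]) (erule left, erule right, rule *)
qed

section \<open>Sorting the elements of a clique around a gap\<close>

definition split_at :: "real \<Rightarrow> real \<Rightarrow> (real \<times> nat) set \<Rightarrow> (real \<times> nat) set \<Rightarrow> bool" where
  "split_at lo hi A B \<longleftrightarrow> row (A \<union> B) \<and> 0 \<le> lo \<and> lo < hi \<and> hi \<le> 1 \<and>
     (\<forall>p\<in>A. fst p \<le> lo) \<and> (\<forall>p\<in>B. hi \<le> fst p)"

lemma above_split: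
  assumes "split_at lo hi A B" "lo < m" "m \<le> hi"
  shows "above m (A \<union> B) = B"
proof -
  have "\<forall>p\<in>A. \<not> m \<le> fst p" "\<forall>p\<in>B. m \<le> fst p"
    using assms unfolding split_at_def by auto
  then show ?thesis
    unfolding above_def by blast
qed

lemma below_split:
  assumes "split_at lo hi A B" "lo \<le> m" "m < hi"
  shows "below m (A \<union> B) = A"
proof -
  have "\<forall>p\<in>A. fst p \<le> m" "\<forall>p\<in>B. \<not> fst p \<le> m"
    using assms unfolding split_at_def by auto
  then show ?thesis
    unfolding below_def by blast
qed

lemma split_at_card:
  assumes "split_at lo hi A B"
  shows "card (A \<union> B) = card A + card B"
proof (rule card_Un_disjoint)
  show "A \<inter> B = {}"
    using assms unfolding split_at_def by (metis disjoint_iff leD order.strict_trans1 order.trans)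
qed (use assms in \<open>auto simp: split_at_def row_def\<close>)

text \<open>What is known after further elements were sorted by \<open>G\<close> into the gap from
  \<open>lo\<close> to \<open>hi\<close>. Besides the colours, the positions of the newcomers are
  recorded; the bound \<open>fst p < hi\<close> later places them before elements presented
  earlier.\<close>

definition sorted_into ::
  "(nat \<Rightarrow> bool) \<Rightarrow> real \<Rightarrow> real \<Rightarrow> (real \<times> nat) set \<Rightarrow> (real \<times> nat) set \<Rightarrow>
    real \<Rightarrow> real \<Rightarrow> (real \<times> nat) set \<Rightarrow> (real \<times> nat) set \<Rightarrow> bool" where
  "sorted_into G lo hi A B lo' hi' A' B' \<longleftrightarrow>
     split_at lo' hi' A' B' \<and> A \<subseteq> A' \<and> B \<subseteq> B' \<and> lo \<le> lo' \<and> hi' \<le> hi \<and>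
     (\<forall>p\<in>A' - A. lo < fst p \<and> G (snd p)) \<and> (\<forall>p\<in>B' - B. fst p < hi \<and> \<not> G (snd p))"

lemma sorted_into_insert_left:
  assumes "sorted_into G z hi (insert (z, c) A) B lo' hi' A' B'" "G c" "lo < z"
  shows "sorted_into G lo hi A B lo' hi' A' B'"
proof -
  have "lo < fst p \<and> G (snd p)" if "p \<in> A' - A" for p
    using assms that unfolding sorted_into_def by (cases "p = (z, c)") force+
  then show ?thesis
    using assms unfolding sorted_into_def by auto
qed

lemma sorted_into_insert_right:
  assumes "sorted_into G lo z A (insert (z, c) B) lo' hi' A' B'" "\<not> G c" "z < hi"
  shows "sorted_into G lo hi A B lo' hi' A' B'"
proof -
  have "fst p < hi \<and> \<not> G (snd p)" if "p \<in> B' - B" for p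
    using assms that unfolding sorted_into_def by (cases "p = (z, c)") force+
  then show ?thesis
    using assms unfolding sorted_into_def by auto
qed

text \<open>Every newcomer is put inside the gap, and its colour decides which end of the gap moves
  up to it, so a free gap always remains. The predicate \<open>W\<close> is abstract in order to
  serve both the left and the right clique.\<close>

lemma sort_gap:
  assumes step: "\<And>Z z. row Z \<Longrightarrow> card Z < w \<Longrightarrow> 0 < z \<Longrightarrow> z < 1 \<Longrightarrow>
      (\<And>c. c \<notin> snd ` Z \<Longrightarrow> W (insert (z, c) Z)) \<Longrightarrow> W Z"
    and split: "split_at lo hi A B" and start: "card A \<le> a" "card B \<le> b" "card (A \<union> B) \<le> n"
    and n: "n \<le> w"
    and stop: "\<And>lo' hi' A' B'. sorted_into G lo hi A B lo' hi' A' B' \<Longrightarrow>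
      card A' \<le> a \<Longrightarrow> card B' \<le> b \<Longrightarrow> card (A' \<union> B') \<le> n \<Longrightarrow>
      card A' = a \<or> card B' = b \<or> card (A' \<union> B') = n \<Longrightarrow> W (A' \<union> B')"
  shows "W (A \<union> B)"
proof -
  \<comment> \<open>The hypothesis \<open>stop\<close> refers to the initial gap. As a predicate of
    the current state it can be carried along in the induction while the gap shrinks.\<close>
  define Q where "Q = (\<lambda>lo hi A B. \<forall>lo' hi' A' B'. sorted_into G lo hi A B lo' hi' A' B' \<longrightarrow>
    card A' \<le> a \<longrightarrow> card B' \<le> b \<longrightarrow> card (A' \<union> B') \<le> n \<longrightarrow>
    card A' = a \<or> card B' = b \<or> card (A' \<union> B') = n \<longrightarrow> W (A' \<union> B'))"
  have "W (A \<union> B)"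
    if "n - card (A \<union> B) = d" "Q lo hi A B" "split_at lo hi A B" "card A \<le> a" "card B \<le> b"
      "card (A \<union> B) \<le> n" for d lo hi A B
    using that
  proof (induction d arbitrary: lo hi A B)
    case 0
    then have "sorted_into G lo hi A B lo hi A B"
      by (simp add: sorted_into_def)
    with 0 show ?case
      unfolding Q_def by auto
  next
    case (Suc d)
    note split = Suc.prems(3)
    show ?case
    proof (cases "card A = a \<or> card B = b")
      case True
      have "sorted_into G lo hi A B lo hi A B"
        using split by (simp add: sorted_into_def)
      with True Suc.prems(2,4-6) show ?thesis
        unfolding Q_def by auto
    next
      case False
      \<comment> \<open>The midpoint is chosen before the colour is known: afterwards
        \<open>z\<close> becomes the new \<open>lo\<close> if \<open>G c\<close> holds and the new
        \<open>hi\<close> otherwise.\<close>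
      define z where "z = (lo + hi) / 2"
      have row: "row (A \<union> B)" and lohi: "0 \<le> lo" "lo < z" "z < hi" "hi \<le> 1"
        using split by (auto simp: split_at_def z_def)
      then have fin: "finite A" "finite B"
        unfolding row_def by simp_all
      show ?thesis
      proof (rule step)
        fix c assume c: "c \<notin> snd ` (A \<union> B)"
        have new: "(z, c) \<notin> A \<union> B"
          using c by force
        have row': "row (insert (z, c) (A \<union> B))"
          using row lohi c by (intro row_insert) auto
        have card: "card (insert (z, c) (A \<union> B)) = Suc (card (A \<union> B))"
          using fin new by simp
        show "W (insert (z, c) (A \<union> B))"
        proof (cases "G c")
          case True
          have "W (insert (z, c) A \<union> B)"
          proof (rule Suc.IH[of _ _ z hi])
            show "split_at z hi (insert (z, c) A) B"
              using split row' lohi unfolding split_at_def by fastforce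
            show "card (insert (z, c) A) \<le> a"
              using fin False new Suc.prems(4) by simp
            show "Q z hi (insert (z, c) A) B"
              using Suc.prems(2) sorted_into_insert_left[of G z hi c A B, OF _ True lohi(2)]
              unfolding Q_def by blast
          qed (use card False Suc.prems in auto)
          then show ?thesis by simp
        next
          case nG: False
          have "W (A \<union> insert (z, c) B)"
          proof (rule Suc.IH[of _ _ lo z])
            show "split_at lo z A (insert (z, c) B)"
              using split row' lohi unfolding split_at_def by fastforce
            show "card (insert (z, c) B) \<le> b"
              using fin False new Suc.prems(5) by simp
            show "Q lo z A (insert (z, c) B)"
              using Suc.prems(2) sorted_into_insert_right[of G lo z A c B, OF _ nG lohi(3)]
              unfolding Q_def by blast
          qed (use card False Suc.prems in auto)
          then show ?thesis by simp
        qed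
      qed (use row lohi n Suc.prems(1) in auto)
    qed
  qed
  moreover have "Q lo hi A B"
    unfolding Q_def using stop by blast
  ultimately show ?thesis
    using split start by blast
qed

lemma above_empty [simp]: "above a {} = {}" and below_empty [simp]: "below a {} = {}"
  by (simp_all add: above_def below_def)

lemma above_Pair: "above a (Pair m ` C) = (if a \<le> m then Pair m ` C else {})"
  and below_Pair: "below a (Pair m ` C) = (if m \<le> a then Pair m ` C else {})"
  by (auto simp: above_def below_def)

lemma card_Pair_image: "card (Pair m ` C) = card C"
  by (intro card_image inj_onI) simp

lemma row_Pair_image: "finite C \<Longrightarrow> 0 < m \<Longrightarrow> m < 1 \<Longrightarrow> row (Pair m ` C)"
  unfolding row_def by (auto simp: inj_on_def)

lemma card_above_antimono: "row Z \<Longrightarrow> a \<le> b \<Longrightarrow> card (above b Z) \<le> card (above a Z)"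
  by (intro card_mono above_antimono finite_subset[OF above_subset row_finite])

lemma card_below_mono: "row Z \<Longrightarrow> a \<le> b \<Longrightarrow> card (below a Z) \<le> card (below b Z)"
  by (intro card_mono below_mono finite_subset[OF below_subset row_finite])

lemma card_snd_Un:
  assumes "row A" "row B" "snd ` A \<inter> snd ` B = {}"
  shows "card (snd ` (A \<union> B)) = card A + card B"
  using assms by (simp add: image_Un card_Un_disjoint row_finite row_card_snd)

section \<open>Winning configurations\<close>

text \<open>All \<open>n\<close> intervals at \<open>m\<close> meet both segments, so their colours
  are new with respect to two colour-disjoint sets.\<close>

lemma fork:
  assumes rows: "row X" "row Y" and m: "0 < m" "m < 1"
    and room: "card (above m X) + n \<le> w" "card (below m Y) + n \<le> w"
    and disj: "snd ` above m X \<inter> snd ` below m Y = {}"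
    and K: "K \<le> card (above m X) + card (below m Y) + n"
  shows "wins w K (place X {} Y)"
proof (rule fill_wins[where n = n])
  have "card (snd ` (above m X \<union> below m Y)) = card (above m X) + card (below m Y)"
    by (intro card_snd_Un row_subset[OF rows(1) above_subset] row_subset[OF rows(2) below_subset] disj)
  with K show "K \<le> card (snd ` (above m X \<union> {} \<union> below m Y)) + n"
    by simp
next
  fix a assume "m \<le> a"
  then show "card (above a X) + card (below a {}) + n \<le> w"
    using card_above_antimono[OF rows(1), of m a] room by simp
next
  fix a assume "a \<le> m"
  then show "card (above a {}) + card (below a Y) + n \<le> w"
    using card_below_mono[OF rows(2), of a m] room by simp
qed (use rows m in simp_all)

text \<open>The \<open>k\<close> intervals at \<open>m\<close> bring the total to
  \<open>3 * k + 1\<close> colours. By \<open>covered\<close>, an interval at \<open>m'\<close>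
  still sees all of these colours, although it meets fewer elements of \<open>X\<close>, so it needs
  one more.\<close>

lemma finish:
  assumes rows: "row X" "row Y" and k: "0 < k" and m: "0 < m" "m < m'" "m' < 1"
    and at_m: "card (above m X) = Suc k" "card (below m Y) = k"
    and disj: "snd ` above m X \<inter> snd ` below m Y = {}"
    and at_m': "card (above m' X) \<le> k" "card (below m' Y) \<le> 2 * k"
    and covered: "snd ` above m X \<subseteq> snd ` above m' X \<union> snd ` below m' Y"
  shows "wins (2 * k + 1) (3 * k + 2) (place X {} Y)"
proof (rule fill[where n = k and m = m])
  fix C assume C: "finite C" "card C = k" "C \<inter> snd ` (above m X \<union> {} \<union> below m Y) = {}"
  let ?M = "Pair m ` C"
  have rowM: "row ?M"
    using m C(1) by (intro row_Pair_image) auto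
  have "wins (2 * k + 1) (3 * k + 2) (place X ?M Y)"
  proof (rule fill_wins[where n = 1 and m = m'])
    fix a assume "m' \<le> a"
    then show "card (above a X) + card (below a ?M) + 1 \<le> 2 * k + 1"
      using card_above_antimono[OF rows(1), of m' a] at_m' C m
      by (simp add: below_Pair card_Pair_image)
  next
    \<comment> \<open>If \<open>a \<le> m\<close>, the window contains the \<open>k\<close> middle
      intervals but at most \<open>k\<close> elements of \<open>Y\<close>; if \<open>a > m\<close>,
      it contains no middle interval, which leaves room for \<open>2 * k\<close> elements of
      \<open>Y\<close>.\<close>
    fix a assume "a \<le> m'"
    then show "card (above a ?M) + card (below a Y) + 1 \<le> 2 * k + 1"
      using card_below_mono[OF rows(2), of a m'] card_below_mono[OF rows(2), of a m] at_m at_m' C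
      by (auto simp: above_Pair card_Pair_image)
  next
    have "card (snd ` (above m X \<union> below m Y)) = 2 * k + 1"
      using at_m by (subst card_snd_Un[OF row_subset[OF rows(1) above_subset]
            row_subset[OF rows(2) below_subset] disj]) simp
    moreover have "finite (snd ` (above m X \<union> below m Y))"
      using rows by (auto intro: finite_subset[OF above_subset] finite_subset[OF below_subset] row_finite)
    ultimately have "card (C \<union> snd ` (above m X \<union> below m Y)) = 3 * k + 1"
      using C by (subst card_Un_disjoint) auto
    moreover have "C \<union> snd ` (above m X \<union> below m Y) \<subseteq> snd ` (above m' X \<union> ?M \<union> below m' Y)"
    proof -
      have "snd ` below m Y \<subseteq> snd ` below m' Y"
        using m by (intro image_mono below_mono) simp
      then have "snd ` above m X \<union> snd ` below m Y \<subseteq> snd ` above m' X \<union> snd ` below m' Y"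
        using covered by (simp add: le_supI2)
      then have "C \<union> (snd ` above m X \<union> snd ` below m Y) \<subseteq>
          C \<union> (snd ` above m' X \<union> snd ` below m' Y)"
        by (rule Un_mono[OF order_refl])
      then show ?thesis
        by (simp add: image_Un image_image Un_ac)
    qed
    moreover have "finite (snd ` (above m' X \<union> ?M \<union> below m' Y))"
      using rows C(1)
      by (auto intro: finite_subset[OF above_subset] finite_subset[OF below_subset] row_finite)
    ultimately have "3 * k + 1 \<le> card (snd ` (above m' X \<union> ?M \<union> below m' Y))"
      by (metis card_mono)
    then show "3 * k + 2 \<le> card (snd ` (above m' X \<union> ?M \<union> below m' Y)) + 1"
      by simp
  qed (use rows rowM m in simp_all)
  then show "wins (2 * k + 1) (3 * k + 2) (place X ({} \<union> ?M) Y)"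
    by simp
next
  fix a assume "m \<le> a"
  then show "card (above a X) + card (below a {}) + k \<le> 2 * k + 1"
    using card_above_antimono[OF rows(1), of m a] at_m by simp
next
  fix a assume "a \<le> m"
  then show "card (above a {}) + card (below a Y) + k \<le> 2 * k + 1"
    using card_below_mono[OF rows(2), of a m] at_m by simp
qed (use rows m in simp_all)

text \<open>
  The segments have k + 1 elements each and disjoint colours, but no point meets both of them. Middle
  elements are played at m until colour d or e appears. If e appears, the rest goes to \<open>\<rho>\<close>, where d is
  excluded, and symmetrically for d; if neither appears, one more interval at \<open>\<gamma>\<close> suffices.
\<close>

lemma inverted:
  assumes rows: "row X" "row Y" and k: "0 < k" and pos: "0 < \<rho>" "\<rho> < \<gamma>" "\<gamma> < 1"
    and X: "above \<rho> X = insert (\<rho>, d) X0" "\<forall>p\<in>X0. \<gamma> \<le> fst p" "card X0 = k" "d \<notin> snd ` X0"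
    and Y: "below \<gamma> Y = insert (\<gamma>, e) Y0" "\<forall>p\<in>Y0. fst p \<le> \<rho>" "card Y0 = k" "e \<notin> snd ` Y0"
    and disj: "snd ` X0 \<inter> snd ` Y0 = {}" "d \<notin> snd ` Y0" "e \<notin> snd ` X0" "d \<noteq> e"
  shows "wins (2 * k + 1) (3 * k + 2) (place X {} Y)"
proof -
  define m where "m = (\<rho> + \<gamma>) / 2"
  have m: "\<rho> < m" "m < \<gamma>" "0 < m" "m < 1"
    using pos by (auto simp: m_def)
  have X0: "above a X = X0" if "\<rho> < a" "a \<le> \<gamma>" for a
  proof -
    have "above a X = above a (above \<rho> X)"
      using that by (auto simp: above_def)
    also have "\<dots> = X0"
      unfolding X(1) using that X(2) by (auto simp: above_def)
    finally show ?thesis .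
  qed
  have Y0: "below a Y = Y0" if "\<rho> \<le> a" "a < \<gamma>" for a
  proof -
    have "below a Y = below a (below \<gamma> Y)"
      using that by (auto simp: below_def)
    also have "\<dots> = Y0"
      unfolding Y(1) using that Y(2) by (auto simp: below_def)
    finally show ?thesis .
  qed
  have row0: "row X0" "row Y0"
    using X0[of m] Y0[of m] m row_subset[OF rows(1) above_subset] row_subset[OF rows(2) below_subset]
    by (metis less_imp_le)+
  have fin: "finite X0" "finite Y0"
    using row0 row_finite by auto
  have cardX: "card (above \<rho> X) = Suc k" and cardY: "card (below \<gamma> Y) = Suc k"
  proof -
    have "(\<rho>, d) \<notin> X0" "(\<gamma>, e) \<notin> Y0"
      using X(4) Y(4) by force+
    then show "card (above \<rho> X) = Suc k" "card (below \<gamma> Y) = Suc k"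
      using X(1,3) Y(1,3) fin by simp_all
  qed
  have colours: "card (snd ` X0 \<union> snd ` Y0) = 2 * k"
    using card_snd_Un[OF row0 disj(1)] X Y by (simp add: image_Un)
  \<comment> \<open>An interval at \<open>\<gamma>\<close> sees the \<open>2 * k\<close> colours of
    \<open>X0\<close> and \<open>Y0\<close>, the colour \<open>e\<close> and all of
    \<open>C\<close>; with \<open>card C + i = Suc k\<close> the total is \<open>3 * k + 2\<close>.
    At \<open>\<rho>\<close> the colour \<open>d\<close> takes the place of
    \<open>e\<close>.\<close>
  have right_end: "wins (2 * k + 1) (3 * k + 2) (place X (Pair m ` C) Y)"
    if C: "finite C" "card C \<le> k" "C \<inter> (snd ` X0 \<union> snd ` Y0) = {}" "e \<notin> C"
      "card C + i = Suc k" "0 < i" "C \<noteq> {}" for C i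
  proof (rule fill_wins[where n = i and m = \<gamma>])
    fix a assume "\<gamma> \<le> a"
    then have "card (above a X) \<le> k"
      using card_above_antimono[OF rows(1), of \<gamma> a] X0[of \<gamma>] X(3) pos by simp
    then show "card (above a X) + card (below a (Pair m ` C)) + i \<le> 2 * k + 1"
      using C by (auto simp: below_Pair card_Pair_image)
  next
    fix a assume a: "a \<le> \<gamma>"
    show "card (above a (Pair m ` C)) + card (below a Y) + i \<le> 2 * k + 1"
    proof (cases "a \<le> m")
      case True
      then have "card (below a Y) \<le> k"
        using card_below_mono[OF rows(2), of a m] Y0[of m] Y(3) m by simp
      then show ?thesis
        using C True by (simp add: above_Pair card_Pair_image)
    next
      case False
      \<comment> \<open>This window contains up to \<open>k + 1\<close> elements of
        \<open>Y\<close>, so \<open>i \<le> k\<close> is required; it holds because \<open>C\<close>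
        is nonempty.\<close>
      have "0 < card C"
        using C by (simp add: card_gt_0_iff)
      then show ?thesis
        using C False card_below_mono[OF rows(2) a] cardY
        by (simp add: above_Pair)
    qed
  next
    have "snd ` (above \<gamma> X \<union> Pair m ` C \<union> below \<gamma> Y) = insert e (C \<union> (snd ` X0 \<union> snd ` Y0))"
      using X0[of \<gamma>] Y(1) pos by (simp add: image_Un image_image Un_ac)
    moreover have "card \<dots> = Suc (card C + 2 * k)"
      using C fin disj Y(4) colours by (auto simp: card_Un_disjoint)
    ultimately show "3 * k + 2 \<le> card (snd ` (above \<gamma> X \<union> Pair m ` C \<union> below \<gamma> Y)) + i"
      using C(5) by simp
  qed (use rows pos m C in \<open>simp_all add: row_Pair_image\<close>)
  have left_end: "wins (2 * k + 1) (3 * k + 2) (place X (Pair m ` C) Y)"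
    if C: "finite C" "C \<inter> (snd ` X0 \<union> snd ` Y0) = {}" "d \<notin> C" "card C + i = Suc k" "0 < i" "C \<noteq> {}"
    for C i
  proof (rule fill_wins[where n = i and m = \<rho>])
    fix a assume a: "\<rho> \<le> a"
    show "card (above a X) + card (below a (Pair m ` C)) + i \<le> 2 * k + 1"
    proof (cases "m \<le> a")
      case True
      then have "card (above a X) \<le> k"
        using card_above_antimono[OF rows(1), of m a] X0[of m] X(3) m by simp
      then show ?thesis
        using C True by (simp add: below_Pair card_Pair_image)
    next
      case False
      have "0 < card C"
        using C by (simp add: card_gt_0_iff)
      then show ?thesis
        using C False card_above_antimono[OF rows(1) a] cardX
        by (simp add: below_Pair)
    qed
  next
    fix a assume "a \<le> \<rho>"
    then have "card (below a Y) \<le> k"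
      using card_below_mono[OF rows(2), of a \<rho>] Y0[of \<rho>] Y(3) pos by simp
    then show "card (above a (Pair m ` C)) + card (below a Y) + i \<le> 2 * k + 1"
      using C by (auto simp: above_Pair card_Pair_image)
  next
    have "snd ` (above \<rho> X \<union> Pair m ` C \<union> below \<rho> Y) = insert d (C \<union> (snd ` X0 \<union> snd ` Y0))"
      using Y0[of \<rho>] X(1) pos by (simp add: image_Un image_image Un_ac)
    moreover have "card \<dots> = Suc (card C + 2 * k)"
      using C fin disj X(4) colours by (auto simp: card_Un_disjoint)
    ultimately show "3 * k + 2 \<le> card (snd ` (above \<rho> X \<union> Pair m ` C \<union> below \<rho> Y)) + i"
      using C(4) by simp
  qed (use rows pos m C in \<open>simp_all add: row_Pair_image\<close>)
  have "wins (2 * k + 1) (3 * k + 2) (place X (Pair m ` C) Y)"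
    if "finite C" "card C + i = k" "C \<inter> (snd ` X0 \<union> snd ` Y0) = {}" "d \<notin> C" "e \<notin> C" for C i
    using that
  proof (induction i arbitrary: C)
    case 0
    then show ?case
      using k by (intro right_end[where i = 1]) auto
  next
    case (Suc i)
    have rowM: "row (Pair m ` C)"
      using Suc.prems m by (intro row_Pair_image) auto
    show ?case
    proof (rule M_step[where m = m])
      fix c assume "c \<notin> snd ` (above m X \<union> Pair m ` C \<union> below m Y)"
      then have c: "c \<notin> snd ` X0" "c \<notin> snd ` Y0" "c \<notin> C"
        using X0[of m] Y0[of m] m by (simp_all add: image_Un image_image)
      \<comment> \<open>Continuing at an end of the range allows \<open>k + 1\<close> middle
        intervals altogether instead of \<open>k\<close>, hence \<open>Suc i\<close> rather than
        \<open>i\<close> further ones once \<open>d\<close> or \<open>e\<close> has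
        appeared.\<close>
      have "wins (2 * k + 1) (3 * k + 2) (place X (Pair m ` insert c C) Y)"
      proof (cases "c = e")
        case True
        then show ?thesis
          using Suc.prems c disj by (intro left_end[where i = "Suc i"]) auto
      next
        case ne: False
        show ?thesis
        proof (cases "c = d")
          case True
          then show ?thesis
            using Suc.prems c disj by (intro right_end[where i = "Suc i"]) auto
        next
          case False
          then show ?thesis
            using Suc.prems c ne by (intro Suc.IH) auto
        qed
      qed
      then show "wins (2 * k + 1) (3 * k + 2) (place X (insert (m, c) (Pair m ` C)) Y)"
        by simp
    next
      fix a assume "m \<le> a"
      then show "card (above a X) + card (below a (Pair m ` C)) < 2 * k + 1"
        using card_above_antimono[OF rows(1), of m a] X0[of m] X(3) m Suc.prems
        by (simp add: below_Pair card_Pair_image)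
    next
      fix a assume "a \<le> m"
      then show "card (above a (Pair m ` C)) + card (below a Y) < 2 * k + 1"
        using card_below_mono[OF rows(2), of a m] Y0[of m] Y(3) m Suc.prems
        by (simp add: above_Pair card_Pair_image)
    qed (use rows rowM m in simp_all)
  qed
  from this[of "{}" k] show ?thesis
    by simp
qed

section \<open>Presenter strategies\<close>

lemma sort_X:
  assumes Y: "row Y" and sort: "split_at lo hi A B" "card A \<le> a" "card B \<le> b" "card (A \<union> B) \<le> n" "n \<le> w"
    and stop: "\<And>lo' hi' A' B'. sorted_into G lo hi A B lo' hi' A' B' \<Longrightarrow>
      card A' \<le> a \<Longrightarrow> card B' \<le> b \<Longrightarrow> card (A' \<union> B') \<le> n \<Longrightarrow>
      card A' = a \<or> card B' = b \<or> card (A' \<union> B') = n \<Longrightarrow> wins w K (place (A' \<union> B') {} Y)"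
  shows "wins w K (place (A \<union> B) {} Y)"
proof (rule sort_gap[where W = "\<lambda>X. wins w K (place X {} Y)" and G = G, OF _ sort])
  fix Z z
  assume Z: "row Z" "card Z < w" and z: "0 < z" "z < 1" and reply: "\<And>c. c \<notin> snd ` Z \<Longrightarrow> wins w K (place (insert (z, c) Z) {} Y)"
  show "wins w K (place Z {} Y)"
    by (rule X_step[OF Z Y z]) (rule reply)
next
  fix lo' hi' A' B'
  assume "sorted_into G lo hi A B lo' hi' A' B'" "card A' \<le> a" "card B' \<le> b"
    "card (A' \<union> B') \<le> n" "card A' = a \<or> card B' = b \<or> card (A' \<union> B') = n"
  then show "wins w K (place (A' \<union> B') {} Y)"
    by (rule stop)
qed

lemma sort_Y:
  assumes X: "row X" and sort: "split_at lo hi A B" "card A \<le> a" "card B \<le> b" "card (A \<union> B) \<le> n" "n \<le> w"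
    and stop: "\<And>lo' hi' A' B'. sorted_into G lo hi A B lo' hi' A' B' \<Longrightarrow>
      card A' \<le> a \<Longrightarrow> card B' \<le> b \<Longrightarrow> card (A' \<union> B') \<le> n \<Longrightarrow>
      card A' = a \<or> card B' = b \<or> card (A' \<union> B') = n \<Longrightarrow> wins w K (place X {} (A' \<union> B'))"
  shows "wins w K (place X {} (A \<union> B))"
proof (rule sort_gap[where W = "\<lambda>Y. wins w K (place X {} Y)" and G = G, OF _ sort])
  fix Z z
  assume Z: "row Z" "card Z < w" and z: "0 < z" "z < 1" and reply: "\<And>c. c \<notin> snd ` Z \<Longrightarrow> wins w K (place X {} (insert (z, c) Z))"
  show "wins w K (place X {} Z)"
    by (rule Y_step[OF Z X z]) (rule reply)
next
  fix lo' hi' A' B'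
  assume "sorted_into G lo hi A B lo' hi' A' B'" "card A' \<le> a" "card B' \<le> b"
    "card (A' \<union> B') \<le> n" "card A' = a \<or> card B' = b \<or> card (A' \<union> B') = n"
  then show "wins w K (place X {} (A' \<union> B'))"
    by (rule stop)
qed

lemma card_le_colours:
  assumes "row A" "finite B" "snd ` A \<subseteq> snd ` B"
  shows "card A \<le> card B"
proof -
  have "card (snd ` A) \<le> card (snd ` B)"
    using assms by (intro card_mono) auto
  then show ?thesis
    using assms card_image_le[of B snd] by (simp add: row_card_snd)
qed

lemma disjoint_coloursI: "(\<And>p. p \<in> A \<Longrightarrow> snd p \<notin> S) \<Longrightarrow> S \<inter> snd ` A = {}"
  by auto

text \<open>Keeping \<open>X\<close> in the upper half leaves the lower half free for inserting
  elements of \<open>Y\<close> at coordinates where a middle interval meets all of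
  \<open>X\<close>.\<close>

lemma start_block:
  assumes "h \<le> w"
    and next_phase: "\<And>X. row X \<Longrightarrow> card X = h \<Longrightarrow> \<forall>p\<in>X. 1 / 2 < fst p \<Longrightarrow> wins w K (place X {} {})"
  shows "wins w K {}"
proof -
  have "wins w K (place ({} \<union> {}) {} {})"
  \<comment> \<open>Nothing is sorted to the left, so the limits \<open>a = 1\<close> and
    \<open>b = Suc h\<close> are out of reach and sorting stops exactly at
    \<open>n = h\<close>.\<close>
  proof (rule sort_X[where G = "\<lambda>_. False" and lo = "1 / 2" and hi = 1 and a = 1 and b = "Suc h" and n = h])
    fix lo' hi' A B
    assume s: "sorted_into (\<lambda>_. False) (1 / 2) 1 {} {} lo' hi' A B"
      and cards: "card (A \<union> B) \<le> h" "card A = 1 \<or> card B = Suc h \<or> card (A \<union> B) = h"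
    have A: "A = {}"
      using s by (auto simp: sorted_into_def)
    with cards have B: "card B = h"
      by auto
    have "row B" "\<forall>p\<in>B. 1 / 2 < fst p"
      using s A by (force simp: sorted_into_def split_at_def)+
    with A B show "wins w K (place (A \<union> B) {} {})"
      by (simp only: Un_empty_left) (rule next_phase)
  qed (use assms(1) in \<open>simp_all add: split_at_def\<close>)
  then show ?thesis
    by (simp add: place_def)
qed

section \<open>Even width\<close>

lemma wins_even: "wins (2 * h) (3 * h) {}"
proof (rule start_block[where h = h])
  fix X assume X: "row X" "card X = h" "\<forall>p\<in>X. 1 / 2 < fst p"
  have "wins (2 * h) (3 * h) (place X {} ({} \<union> {}))"
  proof (rule sort_Y[where G = "\<lambda>c. c \<notin> snd ` X" and lo = 0 and hi = "1 / 2" and a = h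
        and b = "Suc (2 * h)" and n = "2 * h"])
    fix lo hi A B
    assume s: "sorted_into (\<lambda>c. c \<notin> snd ` X) 0 (1 / 2) {} {} lo hi A B"
      and A: "card A \<le> h" and B: "card B \<le> Suc (2 * h)" and AB: "card (A \<union> B) \<le> 2 * h"
      and stop: "card A = h \<or> card B = Suc (2 * h) \<or> card (A \<union> B) = 2 * h"
    have split: "split_at lo hi A B" and lohi: "0 \<le> lo" "lo < hi" "hi \<le> 1 / 2"
      and "\<forall>p\<in>A. snd p \<notin> snd ` X" "\<forall>p\<in>B. snd p \<in> snd ` X"
      using s unfolding sorted_into_def split_at_def by auto
    then have colours: "snd ` X \<inter> snd ` A = {}" "snd ` B \<subseteq> snd ` X"
      by (simp_all add: disjoint_coloursI image_subset_iff)
    have row: "row (A \<union> B)"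
      using split by (simp add: split_at_def)
    \<comment> \<open>Right of the gap only colours of \<open>X\<close> occur, so even a full
      \<open>Y\<close> with \<open>2 * h\<close> elements has \<open>h\<close> of them on the
      left.\<close>
    have "card B \<le> h"
      using card_le_colours[OF row_subset[OF row] row_finite[OF X(1)] colours(2)] X(2) by simp
    then have A: "card A = h"
      using stop A split_at_card[OF split] by linarith
    define m where "m = (lo + hi) / 2"
    have m: "lo < m" "m < hi" "0 < m" "m < 1 / 2"
      using lohi by (auto simp: m_def)
    have "above m X = X" "below m (A \<union> B) = A"
      using X(3) m below_split[OF split, of m] by (auto simp: above_def)
    then show "wins (2 * h) (3 * h) (place X {} (A \<union> B))"
      using X row m colours A by (intro fork[where m = m and n = h]) auto
  qed (use X(1) in \<open>simp_all add: split_at_def\<close>)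
  then show "wins (2 * h) (3 * h) (place X {} {})"
    by simp
qed simp

section \<open>Odd width\<close>

text \<open>Further elements of \<open>Y\<close> are sorted inside the gap of \<open>X\<close>, new
  colours to the left. Either \<open>k + 1\<close> of these arise and \<open>fork\<close> applies,
  or \<open>Y\<close> fills up; then its right part carries every colour of
  \<open>insert (\<rho>, d) X0\<close>, including \<open>d\<close>, and \<open>finish\<close>
  applies.\<close>

lemma shared_colour:
  assumes k: "0 < k" and X: "split_at lo hi A (insert (\<rho>, d) X0)" "card X0 = k" "d \<notin> snd ` X0"
    and u: "\<rho> < u" "\<forall>p\<in>X0. u \<le> fst p" "u \<le> \<gamma>"
    and Y: "row (insert (\<gamma>, c) Y0)" "\<forall>p\<in>Y0. fst p \<le> lo" "card Y0 \<le> k"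
    and colours: "c \<in> snd ` X0" "snd ` Y0 \<inter> snd ` insert (\<rho>, d) X0 = {}"
  shows "wins (2 * k + 1) (3 * k + 2) (place (A \<union> insert (\<rho>, d) X0) {} (insert (\<gamma>, c) Y0))"
proof -
  let ?R = "insert (\<rho>, d) X0"
  have rowX: "row (A \<union> ?R)" and lohi: "0 \<le> lo" "lo < hi" "hi \<le> \<rho>"
    using X(1) by (auto simp: split_at_def)
  have rowR: "row ?R"
    using rowX by (rule row_subset) auto
  have finX0: "finite X0"
    using row_finite[OF rowR] by simp
  have cardR: "card ?R = Suc k"
    using X(2,3) finX0 by (subst card_insert_disjoint) force+
  have \<gamma>: "\<gamma> < 1"
    using Y(1) by (simp add: row_def)
  have "wins (2 * k + 1) (3 * k + 2) (place (A \<union> ?R) {} (Y0 \<union> {(\<gamma>, c)}))"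
  proof (rule sort_Y[where G = "\<lambda>x. x \<notin> snd ` ?R" and lo = lo and hi = hi and a = "Suc k"
        and b = "2 * k + 2" and n = "2 * k + 1"])
    fix lo' hi' L B
    assume s: "sorted_into (\<lambda>x. x \<notin> snd ` ?R) lo hi Y0 {(\<gamma>, c)} lo' hi' L B"
      and cardL: "card L \<le> Suc k" and "card B \<le> 2 * k + 2" "card (L \<union> B) \<le> 2 * k + 1"
      and stop: "card L = Suc k \<or> card B = 2 * k + 2 \<or> card (L \<union> B) = 2 * k + 1"
    have split: "split_at lo' hi' L B" and lohi': "lo \<le> lo'" "lo' < hi'" "hi' \<le> hi"
      and newL: "\<forall>p\<in>L - Y0. snd p \<notin> snd ` ?R" and newB: "\<forall>p\<in>B - {(\<gamma>, c)}. fst p < hi \<and> snd p \<in> snd ` ?R"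
      and \<gamma>B: "(\<gamma>, c) \<in> B"
      using s unfolding sorted_into_def split_at_def by auto
    have rowY: "row (L \<union> B)"
      using split by (simp add: split_at_def)
    have rowB: "row B"
      using rowY by (rule row_subset) simp
    have L: "snd ` ?R \<inter> snd ` L = {}"
    proof (rule disjoint_coloursI)
      fix p assume "p \<in> L"
      then show "snd p \<notin> snd ` ?R"
        using newL colours(2) by (cases "p \<in> Y0") (simp_all add: disjoint_iff)
    qed
    have B: "snd ` B \<subseteq> snd ` ?R"
    proof (rule image_subsetI)
      fix p assume "p \<in> B"
      then show "snd p \<in> snd ` ?R"
        using newB colours(1) by (cases "p = (\<gamma>, c)") auto
    qed
    have cardB: "card B \<le> Suc k"
      using card_le_colours[OF rowB row_finite[OF rowR] B] cardR by simp
    define m where "m = (lo' + hi') / 2"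
    have m: "lo' < m" "m < hi'" "0 < m" "m < 1"
      using lohi lohi' u \<gamma> by (auto simp: m_def)
    have at_m: "above m (A \<union> ?R) = ?R" "below m (L \<union> B) = L"
      using above_split[OF X(1), of m] below_split[OF split, of m] m lohi' by auto
    show "wins (2 * k + 1) (3 * k + 2) (place (A \<union> ?R) {} (L \<union> B))"
    proof (cases "card L = Suc k")
      case True
      then show ?thesis
        by (intro fork[where m = m and n = k] rowX rowY m) (unfold at_m, use L cardR in simp_all)
    next
      case False
      then have cardL: "card L = k" and cardB: "card B = Suc k"
        using stop cardL cardB split_at_card[OF split] by linarith+
      \<comment> \<open>Past \<open>\<rho>\<close>, but before all of \<open>X0\<close> and before
        \<open>\<gamma>\<close>: only \<open>d\<close> is lost on the left, and
        \<open>\<gamma>\<close> stays outside, so at most \<open>2 * k\<close> elements of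
        \<open>Y\<close> are met.\<close>
      define m' where "m' = (\<rho> + u) / 2"
      have m': "\<rho> < m'" "m' < u" "m < m'" "m' < 1"
        using u m lohi' lohi \<gamma> by (auto simp: m'_def)
      have "above m' (A \<union> ?R) = above m' (above m (A \<union> ?R))"
        using m' by (auto simp: above_def)
      also have "\<dots> = X0"
        unfolding at_m using m' u by (auto simp: above_def)
      finally have X0: "above m' (A \<union> ?R) = X0" .
      have finY: "finite (L \<union> B)"
        using rowY by (rule row_finite)
      have "below m' (L \<union> B) \<subseteq> (L \<union> B) - {(\<gamma>, c)}"
        using m' u by (auto simp: below_def)
      then have "card (below m' (L \<union> B)) \<le> card ((L \<union> B) - {(\<gamma>, c)})"
        using finY by (intro card_mono) auto
      also have "\<dots> = 2 * k"
        using finY \<gamma>B split_at_card[OF split] cardL cardB by simp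
      finally have Ym': "card (below m' (L \<union> B)) \<le> 2 * k" .
      \<comment> \<open>\<open>B\<close> has \<open>k + 1\<close> distinct colours, all from the
        \<open>k + 1\<close> colours of \<open>?R\<close>, so none is missing. As
        \<open>d \<noteq> c\<close>, the element coloured \<open>d\<close> is not the one at
        \<open>\<gamma>\<close> and lies left of \<open>hi\<close>.\<close>
      have "snd ` B = snd ` ?R"
        using B cardB cardR rowB rowR row_finite[OF rowR]
        by (intro card_subset_eq) (simp_all only: row_card_snd finite_imageI)
      then have "d \<in> snd ` B"
        by simp
      then obtain v where v: "(v, d) \<in> B"
        by force
      moreover have "d \<noteq> c"
        using X(3) colours(1) by blast
      ultimately have "v < hi"
        using newB by force
      then have "(v, d) \<in> below m' (L \<union> B)"
        using v m' lohi by (simp add: below_def)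
      then have "snd ` ?R \<subseteq> snd ` X0 \<union> snd ` below m' (L \<union> B)"
        by force
      then show ?thesis
        by (intro finish[where m = m and m' = m'] rowX rowY k m m')
          (unfold at_m X0, use L cardR cardL X(2) Ym' in simp_all)
    qed
  qed (use rowX X(1) Y lohi u \<gamma> row_finite[OF Y(1)] in \<open>auto simp: split_at_def card_insert_if\<close>)
  then show ?thesis
    by simp
qed

text \<open>
  Colours of Y0 reappearing in X are sorted to the left of the new element at \<open>\<rho>\<close>, where they are out
  of reach of the middle intervals.
\<close>

lemma wins_after_marker:
  assumes k: "0 < k" and X0: "row X0" "card X0 = k" "\<forall>p\<in>X0. \<gamma> < fst p"
    and Y: "row (insert (\<gamma>, e) Y0)" "e \<notin> snd ` Y0" "0 \<le> l" "l < \<gamma>" "\<forall>p\<in>Y0. fst p \<le> l" "card Y0 \<le> k"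
    and colours: "snd ` Y0 \<inter> snd ` X0 = {}" "e \<in> snd ` X0 \<or> card Y0 = k"
  shows "wins (2 * k + 1) (3 * k + 2) (place X0 {} (insert (\<gamma>, e) Y0))"
proof -
  let ?Y = "insert (\<gamma>, e) Y0"
  have \<gamma>: "\<gamma> < 1"
    using Y(1) by (simp add: row_def)
  have rowY0: "row Y0"
    using Y(1) by (rule row_subset) auto
  have finY0: "finite Y0"
    using rowY0 by (rule row_finite)
  have "wins (2 * k + 1) (3 * k + 2) (place ({} \<union> X0) {} ?Y)"
  proof (rule sort_X[where G = "\<lambda>x. x \<in> snd ` Y0" and lo = l and hi = \<gamma> and a = "2 * k + 2"
        and b = "Suc k" and n = "2 * k + 1"])
    fix lo hi A R
    assume s: "sorted_into (\<lambda>x. x \<in> snd ` Y0) l \<gamma> {} X0 lo hi A R"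
      and "card A \<le> 2 * k + 2" and cardR: "card R \<le> Suc k" and "card (A \<union> R) \<le> 2 * k + 1"
      and stop: "card A = 2 * k + 2 \<or> card R = Suc k \<or> card (A \<union> R) = 2 * k + 1"
    have split: "split_at lo hi A R" and lohi: "l \<le> lo" "lo < hi" "hi \<le> \<gamma>"
      and A: "snd ` A \<subseteq> snd ` Y0" and sub: "X0 \<subseteq> R"
      and R: "\<forall>p\<in>R - X0. fst p < \<gamma> \<and> snd p \<notin> snd ` Y0"
      using s unfolding sorted_into_def split_at_def by auto
    have rowX: "row (A \<union> R)" and hiR: "\<forall>p\<in>R. hi \<le> fst p"
      using split by (auto simp: split_at_def)
    have rowA: "row A" and rowR: "row R"
      using rowX by (auto intro: row_subset)
    \<comment> \<open>Colours of \<open>Y0\<close> account for at most \<open>k\<close> elements, so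
      \<open>R\<close> reaches size \<open>k + 1\<close> by the time \<open>X\<close> has
      \<open>2 * k + 1\<close> elements. It then has exactly one element outside
      \<open>X0\<close>.\<close>
    have "card A \<le> k"
      using card_le_colours[OF rowA finY0 A] Y(6) by simp
    then have cardR: "card R = Suc k"
      using stop cardR split_at_card[OF split] by linarith
    then have "card (R - X0) = 1"
      using sub X0(2) row_finite[OF X0(1)] by (simp add: card_Diff_subset)
    then obtain \<rho> d where new: "R - X0 = {(\<rho>, d)}"
      by (metis card_1_singletonE surj_pair)
    then have Req: "R = insert (\<rho>, d) X0"
      using sub by blast
    have \<rho>: "hi \<le> \<rho>" "\<rho> < \<gamma>" "d \<notin> snd ` Y0"
    proof -
      have "(\<rho>, d) \<in> R - X0"
        using new by simp
      from this bspec[OF R this] bspec[OF hiR, of "(\<rho>, d)"]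
      show "hi \<le> \<rho>" "\<rho> < \<gamma>" "d \<notin> snd ` Y0"
        by simp_all
    qed
    have d: "d \<notin> snd ` X0"
    proof
      assume "d \<in> snd ` X0"
      then obtain p where "p \<in> X0" "snd p = d"
        by blast
      then have "p = (\<rho>, d)"
        using rowR Req unfolding row_def by (auto simp: inj_on_def)
      then show False
        using new \<open>p \<in> X0\<close> by blast
    qed
    show "wins (2 * k + 1) (3 * k + 2) (place (A \<union> R) {} ?Y)"
    \<comment> \<open>The colour \<open>e\<close> may occur in \<open>X0\<close>, at
      \<open>\<rho>\<close>, or nowhere in \<open>R\<close>; these cases lead to
      \<open>shared_colour\<close>, \<open>finish\<close> and \<open>inverted\<close>.\<close>
    proof (cases "e \<in> snd ` X0")
      case True
      show ?thesis
        unfolding Req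
      proof (rule shared_colour[where u = \<gamma>, OF k split[unfolded Req] X0(2) d \<rho>(2)])
        show "\<forall>p\<in>X0. \<gamma> \<le> fst p" "\<forall>p\<in>Y0. fst p \<le> lo"
          using X0(3) Y(5) lohi by force+
        show "snd ` Y0 \<inter> snd ` insert (\<rho>, d) X0 = {}"
          using colours(1) \<rho>(3) by (simp add: Int_commute)
      qed (use Y True in auto)
    next
      case False
      then have cardY0: "card Y0 = k"
        using colours(2) by blast
      have \<rho>X: "above \<rho> (A \<union> R) = R"
        using split hiR \<rho> X0(3) lohi unfolding Req split_at_def above_def by force
      have \<gamma>X: "above \<gamma> (A \<union> R) = X0"
      proof -
        have "above \<gamma> (A \<union> R) = above \<gamma> (above \<rho> (A \<union> R))"
          using \<rho> by (auto simp: above_def)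
        also have "\<dots> = X0"
          unfolding \<rho>X unfolding Req using \<rho> X0(3) by (auto simp: above_def)
        finally show ?thesis .
      qed
      have \<gamma>Y: "below \<gamma> ?Y = ?Y" and \<rho>Y: "below \<rho> ?Y = Y0"
        using Y lohi \<rho> by (force simp: below_def)+
      have pos: "0 < \<rho>"
        using lohi \<rho> Y by linarith
      show ?thesis
      proof (cases "d = e")
        case True
        \<comment> \<open>Moving from \<open>\<rho>\<close> to \<open>\<gamma>\<close> loses the
          colour \<open>d\<close> in \<open>X\<close> and regains it as \<open>e\<close> in
          \<open>Y\<close>.\<close>
        have cardY: "card ?Y \<le> 2 * k"
          using finY0 cardY0 k by (simp add: card_insert_if)
        show ?thesis
          by (rule finish[where m = \<rho> and m' = \<gamma>, OF rowX Y(1) k pos \<rho>(2) \<gamma>])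
            (unfold \<rho>X \<gamma>X \<gamma>Y \<rho>Y, use cardR cardY0 X0(2) cardY True colours(1) \<rho>(3) in \<open>auto simp: Req\<close>)
      next
        case ne: False
        show ?thesis
        proof (rule inverted[OF rowX Y(1) k pos \<rho>(2) \<gamma>])
          show "above \<rho> (A \<union> R) = insert (\<rho>, d) X0"
            using \<rho>X Req by simp
          show "\<forall>p\<in>X0. \<gamma> \<le> fst p" "\<forall>p\<in>Y0. fst p \<le> \<rho>"
            using X0(3) Y(5) lohi \<rho> by force+
        qed (use X0 Y False ne \<rho> d colours(1) cardY0 \<gamma>Y in auto)
      qed
    qed
  qed (use X0 Y \<gamma> in \<open>auto simp: split_at_def less_imp_le\<close>)
  then show ?thesis
    by simp
qed

text \<open>The marker is the first element of \<open>Y\<close> that repeats a colour of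
  \<open>X\<close>, which is why sorting stops at \<open>b = 1\<close>. If the first
  \<open>k\<close> elements of \<open>Y\<close> all have new colours, the next one is the marker
  whatever its colour.\<close>

lemma wins_odd:
  assumes k: "0 < k"
  shows "wins (2 * k + 1) (3 * k + 2) {}"
proof (rule start_block[where h = k])
  fix X assume X: "row X" "card X = k" "\<forall>p\<in>X. 1 / 2 < fst p"
  have "wins (2 * k + 1) (3 * k + 2) (place X {} ({} \<union> {}))"
  proof (rule sort_Y[where G = "\<lambda>c. c \<notin> snd ` X" and lo = 0 and hi = "1 / 2" and a = "Suc k"
        and b = 1 and n = k])
    fix lo hi A B
    assume s: "sorted_into (\<lambda>c. c \<notin> snd ` X) 0 (1 / 2) {} {} lo hi A B"
      and "card A \<le> Suc k" and cardB: "card B \<le> 1" and cardAB: "card (A \<union> B) \<le> k"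
      and stop: "card A = Suc k \<or> card B = 1 \<or> card (A \<union> B) = k"
    have split: "split_at lo hi A B" and lohi: "0 \<le> lo" "lo < hi" "hi \<le> 1 / 2"
      and colours: "\<forall>p\<in>A. snd p \<notin> snd ` X" and B: "\<forall>p\<in>B. fst p < 1 / 2 \<and> snd p \<in> snd ` X"
      and lo: "\<forall>p\<in>A. fst p \<le> lo" and hi: "\<forall>p\<in>B. hi \<le> fst p"
      using s unfolding sorted_into_def split_at_def by auto
    have A: "snd ` X \<inter> snd ` A = {}"
      using colours by (simp add: disjoint_coloursI)
    have row: "row (A \<union> B)"
      using split by (simp add: split_at_def)
    show "wins (2 * k + 1) (3 * k + 2) (place X {} (A \<union> B))"
    proof (cases "card B = 1")
      case True
      then obtain \<gamma> c where Beq: "B = {(\<gamma>, c)}"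
        by (metis card_1_singletonE surj_pair)
      have "wins (2 * k + 1) (3 * k + 2) (place X {} (insert (\<gamma>, c) A))"
      proof (rule wins_after_marker[OF k X(1,2), where l = lo])
        show "\<forall>p\<in>X. \<gamma> < fst p"
          using X(3) B Beq by force
        show "row (insert (\<gamma>, c) A)"
          using row Beq by simp
        show "c \<notin> snd ` A" "c \<in> snd ` X \<or> card A = k"
          using A B Beq by (simp_all add: disjoint_iff)
        show "snd ` A \<inter> snd ` X = {}"
          using A by (simp only: Int_commute)
        show "lo < \<gamma>"
          using hi Beq lohi by simp
        show "card A \<le> k"
          using cardAB split_at_card[OF split] by simp
      qed (use lohi lo in auto)
      then show ?thesis
        by (simp add: Beq)
    next
      case False
      have finB: "finite B"
        using row_finite[OF row] by simp
      then have "B = {}"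
        using cardB False by (metis card_0_eq le_neq_implies_less less_one)
      with stop cardAB have cardA: "card A = k"
        by auto
      define \<gamma> where "\<gamma> = (lo + hi) / 2"
      have \<gamma>: "lo < \<gamma>" "\<gamma> < 1 / 2" "0 < \<gamma>"
        using lohi by (auto simp: \<gamma>_def)
      have "wins (2 * k + 1) (3 * k + 2) (place X {} A)"
      proof (rule Y_step[where y = \<gamma>])
        show rowA: "row A"
          using row \<open>B = {}\<close> by simp
        fix c assume c: "c \<notin> snd ` A"
        show "wins (2 * k + 1) (3 * k + 2) (place X {} (insert (\<gamma>, c) A))"
        proof (rule wins_after_marker[OF k X(1,2), where l = lo])
          show "\<forall>p\<in>X. \<gamma> < fst p"
            using X(3) \<gamma> by force
          show "row (insert (\<gamma>, c) A)"
            using rowA c \<gamma> by (intro row_insert) auto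
          show "snd ` A \<inter> snd ` X = {}"
            using A by (simp only: Int_commute)
        qed (use lohi lo c cardA \<gamma> in auto)
      qed (use X(1) cardA \<gamma> in auto)
      then show ?thesis
        by (simp add: \<open>B = {}\<close>)
    qed
  qed (use X(1) in \<open>simp_all add: split_at_def\<close>)
  then show "wins (2 * k + 1) (3 * k + 2) (place X {} {})"
    by simp
qed simp

theorem theorem1p1:
  fixes w :: nat
  assumes "w > 1"
  shows "int (olws_R w) \<ge> \<lceil>(3 / 2) * real w\<rceil>"
proof (cases "even w")
  case True
  then obtain h where h: "w = 2 * h"
    by blast
  have "3 * h \<le> olws_R w"
    using wins_empty_imp_forces[OF wins_even[of h]] forces_imp_le_olws_R h by blast
  then show ?thesis
    by (simp add: h ceiling_le_iff)
next
  case False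
  then obtain k where k: "w = 2 * k + 1"
    using oddE by blast
  with assms have "0 < k"
    by simp
  then have "3 * k + 2 \<le> olws_R w"
    using wins_empty_imp_forces[OF wins_odd[of k]] forces_imp_le_olws_R k by blast
  then show ?thesis
    by (simp add: k ceiling_le_iff)
qed

end
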